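(* Let $\tau>-1$ be a real number. Then the Reiswich polynomials $R^\tau_n$, $n\in\mathbb{N}_0$, form a sequence of orthogonal polynomials with respect to the probability measure $\mu^\tau(dx):=(\tau+2)(\tau+1)(1-x)x^\tau\,dx$ on $[0,1]$; more precisely, for all $n,m\in\mathbb{N}_0$ $$ \int_0^1 R^\tau_n(x)\,R^\tau_m(x)\,(\tau+2)(\tau+1)(1-x)\,x^\tau\,dx \;=\; (n+1)!\,n!\,\frac{[\![\,n+\tau+1\,]\!]_{n}\,[\![\,n+\tau\,]\!]_{n}}{[\![\,2n+\tau+2\,]\!]_{2n}\,[\![\,2n+\tau+1\,]\!]_{2n}}\;\delta_{n=m}. $$
   Context: For $r\in\mathbb{N}_0$ the falling factorial is $[\![\,z\,]\!]_r:=z(z-1)\cdots(z-r+1)$, with $[\![\,z\,]\!]_0:=1$. For $n\in\mathbb{N}_0$ and real $\tau>-1$ the Reiswich polynomial $R^\tau_n\in\mathbb{R}[x]$ is $$ R^\tau_n(x):=\sum_{r=0}^n(-1)^r\binom{n}{r}\frac{[\![\,n+\tau\,]\!]_r}{[\![\,2n+\tau+1\,]\!]_r}\,x^{n-r}. $$ Here $\delta_{n=m}$ equals $1$ if $n=m$ and $0$ otherwise. *)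

theory Defs
  imports
    "HOL-Probability.Probability"
    "HOL-Computational_Algebra.Polynomial"
begin

definition falling_fact :: "real \<Rightarrow> nat \<Rightarrow> real" where
  "falling_fact z r = (\<Prod>i<r. z - real i)"

definition reiswich_poly :: "real \<Rightarrow> nat \<Rightarrow> real poly" where
  "reiswich_poly \<tau> n =
     (\<Sum>r\<le>n. monom ((-1) ^ r * real (n choose r)
        * (falling_fact (real n + \<tau>) r / falling_fact (2 * real n + \<tau> + 1) r)) (n - r))"

definition reiswich_measure :: "real \<Rightarrow> real measure" where
  "reiswich_measure \<tau> =
     density (restrict_space lborel {0..1})
       (\<lambda>x. ennreal ((\<tau> + 2) * (\<tau> + 1) * (1 - x) * x powr \<tau>))"

(* The standard notion: exact degree n, products integrable (the Bochner integral of a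
   non-integrable function is 0 by convention), pairwise orthogonal, nonzero norms. *)
definition orthogonal_polynomial_sequence :: "real measure \<Rightarrow> (nat \<Rightarrow> real poly) \<Rightarrow> bool" where
  "orthogonal_polynomial_sequence M p \<longleftrightarrow>
     (\<forall>n. degree (p n) = n) \<and>
     (\<forall>n m. integrable M (\<lambda>x. poly (p n) x * poly (p m) x)) \<and>
     (\<forall>n m. n \<noteq> m \<longrightarrow> (LINT x|M. poly (p n) x * poly (p m) x) = 0) \<and>
     (\<forall>n. (LINT x|M. poly (p n) x * poly (p n) x) \<noteq> 0)"

end

(* On {0..1} the k-th moment of the weight is (\<tau>+2)(\<tau>+1) / ((k+\<tau>+1)(k+\<tau>+2)), and the coefficient of
   x^j in the n-th polynomial is, up to a constant, (-1)^j binom(n,j) (j+\<tau>+1)...(j+\<tau>+n+1).  Hence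
   the integral of R_n x^k is an n-th finite difference in j.  For k < n both linear factors in the
   denominator of the moment cancel, which leaves a polynomial of degree n-1 in j, so the difference
   vanishes; for k = n one denominator survives and the partial fraction expansion of
   n!/(a(a+1)...(a+n)) gives the norm. *)
theory Submission
  imports Defs
begin

section \<open>Alternating binomial sums as iterated differences\<close>

lemma alternating_binomial_sum_Suc:
  fixes f :: "nat \<Rightarrow> 'a::comm_ring_1"
  shows "(\<Sum>j\<le>Suc n. (-1) ^ j * of_nat (Suc n choose j) * f j)
       = (\<Sum>j\<le>n. (-1) ^ j * of_nat (n choose j) * (f j - f (Suc j)))"
proof -
  \<comment> \<open>The upper limit is one too large on purpose: the extra term has
    \<open>n choose Suc n\<close> = 0, and splitting off j = 0 then gives the shape that Pascal's
    rule produces below.\<close>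
  have "(\<Sum>j\<le>Suc n. (-1) ^ j * of_nat (n choose j) * f j)
      = f 0 + (\<Sum>j\<le>n. - ((-1) ^ j * of_nat (n choose Suc j) * f (Suc j)))"
    by (simp add: sum.atMost_Suc_shift del: sum.atMost_Suc)
  then have shift: "(\<Sum>j\<le>n. (-1) ^ j * of_nat (n choose j) * f j)
      = f 0 + (\<Sum>j\<le>n. - ((-1) ^ j * of_nat (n choose Suc j) * f (Suc j)))"
    by (simp add: binomial_eq_0)
  have "(\<Sum>j\<le>Suc n. (-1) ^ j * of_nat (Suc n choose j) * f j)
      = f 0 + (\<Sum>j\<le>n. - ((-1) ^ j * of_nat (n choose Suc j) * f (Suc j))
                 - (-1) ^ j * of_nat (n choose j) * f (Suc j))"
    by (simp add: sum.atMost_Suc_shift algebra_simps minus_diff_commute del: sum.atMost_Suc)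
  also have "\<dots> = (\<Sum>j\<le>n. (-1) ^ j * of_nat (n choose j) * f j)
      - (\<Sum>j\<le>n. (-1) ^ j * of_nat (n choose j) * f (Suc j))"
    unfolding shift by (simp only: sum_subtractf add_diff_eq)
  also have "\<dots> = (\<Sum>j\<le>n. (-1) ^ j * of_nat (n choose j) * (f j - f (Suc j)))"
    by (simp only: sum_subtractf right_diff_distrib)
  finally show ?thesis .
qed

lemma alternating_binomial_sum_poly:
  fixes p :: "'a::idom poly"
  assumes "p = 0 \<or> degree p < n"
  shows "(\<Sum>j\<le>n. (-1) ^ j * of_nat (n choose j) * poly p (of_nat j)) = 0"
  using assms
proof (induction n arbitrary: p)
  case 0
  then show ?case by simp
next
  case (Suc n)
  define q where "q = p - pcompose p [:1, 1:]"
  have deg: "degree (pcompose p [:1, 1:]) = degree p"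
    by (simp add: degree_pcompose)
  have "degree q \<le> degree p"
    unfolding q_def using degree_diff_le[of p "degree p" "pcompose p [:1, 1:]"] deg by simp
  moreover have "coeff q (degree p) = 0"
    using lead_coeff_comp[of "[:1, 1:]" p] unfolding q_def by (simp add: deg)
  ultimately have "q = 0 \<or> degree q < degree p"
    by (rule eq_zero_or_degree_less)
  then have "q = 0 \<or> degree q < n"
    using Suc.prems by (auto simp: q_def)
  from Suc.IH[OF this] show ?case
    unfolding alternating_binomial_sum_Suc by (simp add: q_def poly_pcompose)
qed

text \<open>This is the partial fraction expansion of n!/(a(a+1)...(a+n)). Differencing 1/(j+a) in j
  amounts to subtracting the same sum with a+1 in place of a, so the induction runs over all
  a.\<close>

lemma alternating_binomial_sum_inverse:
  fixes a :: "'a::field_char_0"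
  assumes "\<And>j. j \<le> n \<Longrightarrow> a + of_nat j \<noteq> 0"
  shows "(\<Sum>j\<le>n. (-1) ^ j * of_nat (n choose j) * (1 / (of_nat j + a)))
       = fact n / pochhammer a (Suc n)"
  using assms
proof (induction n arbitrary: a)
  case 0
  then show ?case by simp
next
  case (Suc n)
  have nz: "a + 1 + of_nat j \<noteq> 0" if "j \<le> n" for j
    using Suc.prems[of "Suc j"] that by (simp add: add_ac)
  have a: "a \<noteq> 0" "a + of_nat (Suc n) \<noteq> 0"
    using Suc.prems[of 0] Suc.prems[of "Suc n"] by simp_all
  have p: "pochhammer (a + 1) n \<noteq> 0"
    using nz by (auto simp: pochhammer_eq_0_iff eq_neg_iff_add_eq_0)
  \<comment> \<open>Splitting off the last factor here and the first factor of
    \<open>pochhammer a (Suc n)\<close> leaves the same block \<open>pochhammer (a + 1) n\<close>.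
    The numerators then differ by (a+n+1) - a = n+1, which turns n! into (n+1)!.\<close>
  have rec: "pochhammer (a + 1) (Suc n) = (a + of_nat (Suc n)) * pochhammer (a + 1) n"
    by (simp add: pochhammer_Suc algebra_simps)
  have "(\<Sum>j\<le>Suc n. (-1) ^ j * of_nat (Suc n choose j) * (1 / (of_nat j + a)))
      = (\<Sum>j\<le>n. (-1) ^ j * of_nat (n choose j) * (1 / (of_nat j + a)))
      - (\<Sum>j\<le>n. (-1) ^ j * of_nat (n choose j) * (1 / (of_nat j + (a + 1))))"
    unfolding alternating_binomial_sum_Suc
    by (simp add: sum_subtractf right_diff_distrib add_ac)
  also have "\<dots> = fact n / pochhammer a (Suc n) - fact n / pochhammer (a + 1) (Suc n)"
    using Suc.IH[of a] Suc.IH[of "a + 1"] Suc.prems nz by simp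
  also have "\<dots> = fact n / (a * pochhammer (a + 1) n)
      - fact n / ((a + of_nat (Suc n)) * pochhammer (a + 1) n)"
    by (simp only: pochhammer_rec[of a n] rec)
  also have "\<dots> = fact (Suc n) / (a * ((a + of_nat (Suc n)) * pochhammer (a + 1) n))"
    using a p by (simp add: divide_simps del: of_nat_Suc) (simp add: algebra_simps)
  also have "a * ((a + of_nat (Suc n)) * pochhammer (a + 1) n) = pochhammer a (Suc (Suc n))"
    by (simp only: pochhammer_rec[of a "Suc n"] rec)
  finally show ?case .
qed

text \<open>Division of p by x + a leaves a quotient of degree below n, which the alternating sum
  annihilates, and the constant remainder p(-a), which multiplies the sum of 1/(j+a).\<close>

lemma alternating_binomial_sum_poly_div:
  fixes p :: "'a::field_char_0 poly"
  assumes "degree p \<le> n" and nz: "\<And>j. j \<le> n \<Longrightarrow> a + of_nat j \<noteq> 0"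
  shows "(\<Sum>j\<le>n. (-1) ^ j * of_nat (n choose j) * (poly p (of_nat j) / (of_nat j + a)))
       = poly p (- a) * fact n / pochhammer a (Suc n)"
proof -
  define q where "q = synthetic_div p (- a)"
  have q: "q = 0 \<or> degree q < n"
    using assms(1) by (cases "degree p = 0") (auto simp: q_def degree_synthetic_div synthetic_div_eq_0_iff)
  have expand: "poly p x = (x + a) * poly q x + poly p (- a)" for x
  proof -
    have "poly p x = poly ([:- (- a), 1:] * q + [:poly p (- a):]) x"
      by (simp only: q_def synthetic_div_correct')
    also have "\<dots> = (x + a) * poly q x + poly p (- a)"
      by (simp add: algebra_simps)
    finally show ?thesis .
  qed
  have "poly p (of_nat j) / (of_nat j + a)
      = poly q (of_nat j) + poly p (- a) * (1 / (of_nat j + a))" if "j \<le> n" for j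
    unfolding expand[of "of_nat j"] using nz[OF that] by (simp add: add_divide_distrib add.commute)
  then have "(\<Sum>j\<le>n. (-1) ^ j * of_nat (n choose j) * (poly p (of_nat j) / (of_nat j + a)))
      = (\<Sum>j\<le>n. (-1) ^ j * of_nat (n choose j)
          * (poly q (of_nat j) + poly p (- a) * (1 / (of_nat j + a))))"
    by (intro sum.cong) simp_all
  also have "\<dots> = (\<Sum>j\<le>n. (-1) ^ j * of_nat (n choose j) * poly q (of_nat j))
      + poly p (- a) * (\<Sum>j\<le>n. (-1) ^ j * of_nat (n choose j) * (1 / (of_nat j + a)))"
    by (simp only: distrib_left sum.distrib sum_distrib_left mult.left_commute[of _ "poly p (- a)"])
  also have "\<dots> = poly p (- a) * fact n / pochhammer a (Suc n)"
    by (simp only: alternating_binomial_sum_poly[OF q] alternating_binomial_sum_inverse[OF nz]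
        times_divide_eq_right[of "poly p (- a)"] add_0)
  finally show ?thesis .
qed

section \<open>Closed form of the coefficients\<close>

lemma falling_fact_eq_pochhammer: "falling_fact z r = pochhammer (z - real r + 1) r"
proof -
  have "falling_fact z r = (\<Prod>i<r. z - real (r - Suc i))"
    unfolding falling_fact_def by (rule prod.nat_diff_reindex[symmetric])
  also have "\<dots> = pochhammer (z - real r + 1) r"
    by (auto simp: pochhammer_prod of_nat_diff atLeast0LessThan intro!: prod.cong)
  finally show ?thesis .
qed

text \<open>The defining ratio has products whose length n-j varies with j. Enlarging both by a
  common block gives length n+1 throughout: the numerator becomes a polynomial in j and the
  denominator no longer depends on j.\<close>

lemma coeff_reiswich_poly:
  assumes "\<tau> > -1" "j \<le> n"
  shows "coeff (reiswich_poly \<tau> n) j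
       = (-1) ^ (n + j) * real (n choose j)
           * pochhammer (real j + \<tau> + 1) (Suc n) / pochhammer (real n + \<tau> + 1) (Suc n)"
proof -
  define A B where "A = pochhammer (real j + \<tau> + 1) (n - j)"
    and "B = pochhammer (real n + real j + \<tau> + 2) (n - j)"
  \<comment> \<open>The common block runs from n+\<tau>+1 to n+j+\<tau>+1, so it starts right after
    the last factor of \<open>A\<close> and ends right before the first factor of
    \<open>B\<close>.\<close>
  define C where "C = pochhammer (real n + \<tau> + 1) (Suc j)"
  have pos: "A > 0" "B > 0" "C > 0"
    using assms unfolding A_def B_def C_def by (auto intro!: pochhammer_pos simp del: pochhammer_Suc)
  have "pochhammer (real j + \<tau> + 1) (Suc n) = A * C"
    using assms pochhammer_product[of "n - j" "Suc n" "real j + \<tau> + 1"]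
    by (simp add: A_def C_def Suc_diff_le of_nat_diff add_ac del: pochhammer_Suc)
  moreover have "pochhammer (real n + \<tau> + 1) (Suc n) = C * B"
    using assms pochhammer_product[of "Suc j" "Suc n" "real n + \<tau> + 1"]
    by (simp add: B_def C_def add_ac del: pochhammer_Suc)
  ultimately have ratio: "pochhammer (real j + \<tau> + 1) (Suc n) / pochhammer (real n + \<tau> + 1) (Suc n) = A / B"
    using pos by simp
  have "coeff (reiswich_poly \<tau> n) j
      = (\<Sum>r\<le>n. if r = n - j then (-1) ^ r * real (n choose r)
        * (falling_fact (real n + \<tau>) r / falling_fact (2 * real n + \<tau> + 1) r) else 0)"
    unfolding reiswich_poly_def coeff_sum using assms by (intro sum.cong) auto
  also have "\<dots> = (-1) ^ (n - j) * real (n choose (n - j))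
        * (falling_fact (real n + \<tau>) (n - j) / falling_fact (2 * real n + \<tau> + 1) (n - j))"
    by simp
  also have "falling_fact (real n + \<tau>) (n - j) = A"
    using assms by (simp add: falling_fact_eq_pochhammer A_def of_nat_diff algebra_simps)
  also have "falling_fact (2 * real n + \<tau> + 1) (n - j) = B"
    using assms by (simp add: falling_fact_eq_pochhammer B_def of_nat_diff algebra_simps)
  also have "(-1) ^ (n - j) = (-1 :: real) ^ (n + j)"
    using assms by (auto simp: minus_one_power_iff)
  also have "n choose (n - j) = n choose j"
    using assms by (simp add: binomial_symmetric[symmetric])
  finally show ?thesis
    by (simp only: times_divide_eq_right[symmetric] ratio)
qed

lemma degree_reiswich_poly_le: "degree (reiswich_poly \<tau> n) \<le> n"
  unfolding reiswich_poly_def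
  by (intro degree_sum_le) (auto intro: order.trans[OF degree_monom_le])

text \<open>Only r = 0 contributes, with empty falling factorials. Besides fixing the degree, being
  monic reduces the squared norm to the integral against x^n.\<close>

lemma coeff_reiswich_poly_self: "coeff (reiswich_poly \<tau> n) n = 1"
proof -
  have "coeff (reiswich_poly \<tau> n) n
      = (\<Sum>r\<le>n. if r = 0 then (-1) ^ r * real (n choose r)
        * (falling_fact (real n + \<tau>) r / falling_fact (2 * real n + \<tau> + 1) r) else 0)"
    unfolding reiswich_poly_def coeff_sum by (intro sum.cong) auto
  then show ?thesis
    by (simp add: falling_fact_def)
qed

lemma degree_reiswich_poly: "degree (reiswich_poly \<tau> n) = n"
  by (metis coeff_reiswich_poly_self degree_reiswich_poly_le le_degree order_antisym zero_neq_one)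

section \<open>Moments of the weight\<close>

definition reiswich_moment :: "real \<Rightarrow> nat \<Rightarrow> real" where
  "reiswich_moment \<tau> k = (\<tau> + 2) * (\<tau> + 1) / ((real k + \<tau> + 1) * (real k + \<tau> + 2))"

text \<open>The integrand is nonnegative, so the gauge integral is also the value of the nonnegative
  Lebesgue integral. Its finiteness gives integrability, including the unbounded case a < 0.\<close>

lemma has_bochner_integral_powr_unit:
  fixes a :: real
  assumes "a > -1"
  shows "has_bochner_integral lborel (\<lambda>x. indicator {0..1} x * x powr a) (1 / (a + 1))"
proof (rule has_bochner_integral_nn_integral)
  have "((\<lambda>x. x powr a) has_integral (1 / (a + 1))) {0..1}"
    using has_integral_powr_from_0[OF assms, of 1] by simp
  then show "(\<integral>\<^sup>+x. ennreal (indicator {0..1} x * x powr a) \<partial>lborel) = ennreal (1 / (a + 1))"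
    by (intro nn_integral_has_integral_lebesgue) auto
qed (use assms in auto)

text \<open>Expanding 1 - x leaves two pure powers, and 1/(k+\<tau>+1) - 1/(k+\<tau>+2) is a single
  fraction with numerator 1.\<close>

lemma has_bochner_integral_reiswich_moment:
  assumes "\<tau> > -1"
  shows "has_bochner_integral lborel
      (\<lambda>x. indicator {0..1} x * (x ^ k * ((\<tau> + 2) * (\<tau> + 1) * (1 - x) * x powr \<tau>)))
      (reiswich_moment \<tau> k)"
proof -
  let ?I = "indicator {0..1} :: real \<Rightarrow> real"
  have "has_bochner_integral lborel
      (\<lambda>x. (\<tau> + 2) * (\<tau> + 1) * (?I x * x powr (\<tau> + real k) - ?I x * x powr (\<tau> + real k + 1)))
      ((\<tau> + 2) * (\<tau> + 1) * (1 / (\<tau> + real k + 1) - 1 / (\<tau> + real k + 1 + 1)))"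
    using assms
    by (intro has_bochner_integral_mult_right has_bochner_integral_diff
        has_bochner_integral_powr_unit) auto
  also have "(\<tau> + 2) * (\<tau> + 1) * (1 / (\<tau> + real k + 1) - 1 / (\<tau> + real k + 1 + 1))
      = reiswich_moment \<tau> k"
    using assms by (simp add: reiswich_moment_def diff_frac_eq add_ac)
  also have "(\<lambda>x. (\<tau> + 2) * (\<tau> + 1) * (?I x * x powr (\<tau> + real k) - ?I x * x powr (\<tau> + real k + 1)))
      = (\<lambda>x. ?I x * (x ^ k * ((\<tau> + 2) * (\<tau> + 1) * (1 - x) * x powr \<tau>)))"
  proof
    fix x :: real
    show "(\<tau> + 2) * (\<tau> + 1) * (?I x * x powr (\<tau> + real k) - ?I x * x powr (\<tau> + real k + 1))
        = ?I x * (x ^ k * ((\<tau> + 2) * (\<tau> + 1) * (1 - x) * x powr \<tau>))"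
    \<comment> \<open>Exponents of \<open>powr\<close> are combined only for positive x. At x = 0
      both sides vanish because \<open>0 powr a = 0\<close> for every a, even where x^k is 1; for x
      < 0 the indicator is 0.\<close>
    proof (cases "x > 0")
      case True
      then show ?thesis
        by (simp add: powr_add powr_realpow algebra_simps)
    next
      case False
      then show ?thesis
        by (cases "x = 0") (simp_all add: indicator_def)
    qed
  qed
  finally show ?thesis .
qed

text \<open>The double sum is nested so that each inner sum is the integral of p(x) x^k, the
  quantity that is later evaluated as a whole.\<close>

lemma has_bochner_integral_poly_mult:
  assumes "\<tau> > -1"
  shows "has_bochner_integral lborel
      (\<lambda>x. indicator {0..1} x * (poly p x * poly q x * ((\<tau> + 2) * (\<tau> + 1) * (1 - x) * x powr \<tau>)))
      (\<Sum>k\<le>degree q. coeff q k * (\<Sum>j\<le>degree p. coeff p j * reiswich_moment \<tau> (j + k)))"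
proof -
  let ?f = "\<lambda>k x :: real. indicator {0..1} x * (x ^ k * ((\<tau> + 2) * (\<tau> + 1) * (1 - x) * x powr \<tau>))"
  have "has_bochner_integral lborel
      (\<lambda>x. \<Sum>k\<le>degree q. coeff q k * (\<Sum>j\<le>degree p. coeff p j * ?f (j + k) x))
      (\<Sum>k\<le>degree q. coeff q k * (\<Sum>j\<le>degree p. coeff p j * reiswich_moment \<tau> (j + k)))"
    by (intro has_bochner_integral_sum has_bochner_integral_mult_right
        has_bochner_integral_reiswich_moment assms)
  moreover have "(\<Sum>k\<le>degree q. coeff q k * (\<Sum>j\<le>degree p. coeff p j * ?f (j + k) x))
      = indicator {0..1} x * (poly p x * poly q x * ((\<tau> + 2) * (\<tau> + 1) * (1 - x) * x powr \<tau>))" for x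
  proof -
    have "(\<Sum>k\<le>degree q. coeff q k * (\<Sum>j\<le>degree p. coeff p j * ?f (j + k) x))
        = (\<Sum>k\<le>degree q. coeff q k * x ^ k * (\<Sum>j\<le>degree p. coeff p j * x ^ j)) * ?f 0 x"
      unfolding sum_distrib_left sum_distrib_right
      by (intro sum.cong refl) (simp add: power_add mult_ac)
    also have "(\<Sum>k\<le>degree q. coeff q k * x ^ k * (\<Sum>j\<le>degree p. coeff p j * x ^ j)) = poly p x * poly q x"
      by (simp add: poly_altdef sum_distrib_right[symmetric] mult.commute)
    finally show ?thesis
      by (simp add: mult_ac)
  qed
  ultimately show ?thesis
    by simp
qed

section \<open>The squared norm and the integrals against monomials\<close>

definition reiswich_norm :: "real \<Rightarrow> nat \<Rightarrow> real" where
  "reiswich_norm \<tau> n = (\<tau> + 2) * (\<tau> + 1) * fact n * fact (n + 1)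
     / (pochhammer (real n + \<tau> + 1) (Suc n) * pochhammer (real n + \<tau> + 2) (Suc n))"

lemma reiswich_norm_pos:
  assumes "\<tau> > -1"
  shows "reiswich_norm \<tau> n > 0"
  unfolding reiswich_norm_def using assms
  by (intro divide_pos_pos mult_pos_pos pochhammer_pos) auto

lemma reiswich_norm_eq:
  assumes "\<tau> > -1"
  shows "reiswich_norm \<tau> n = fact (n + 1) * fact n
            * ((falling_fact (real n + \<tau> + 1) n * falling_fact (real n + \<tau>) n)
               / (falling_fact (2 * real n + \<tau> + 2) (2 * n)
                  * falling_fact (2 * real n + \<tau> + 1) (2 * n)))"
proof -
  define A B where "A = pochhammer (\<tau> + 1) n" and "B = pochhammer (\<tau> + 2) n"
  define P Q where "P = pochhammer (real n + \<tau> + 1) (Suc n)"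
    and "Q = pochhammer (real n + \<tau> + 2) (Suc n)"
  have pos: "A > 0" "B > 0" "P > 0" "Q > 0"
    using assms unfolding A_def B_def P_def Q_def
    by (auto intro!: pochhammer_pos simp del: pochhammer_Suc)
  \<comment> \<open>The normalizing factor \<tau>+1 supplies the missing first factor of a rising
    product of length 2n+1, which is then cut after n factors. The factor \<tau>+2 does the same for
    \<open>B\<close> and \<open>Q\<close>.\<close>
  have AP: "(\<tau> + 1) * pochhammer (\<tau> + 2) (2 * n) = A * P"
    using pochhammer_product'[of "\<tau> + 1" n "Suc n"] pochhammer_rec[of "\<tau> + 1" "2 * n"]
    by (simp add: A_def P_def mult_2 add_ac del: pochhammer_Suc)
  have BQ: "(\<tau> + 2) * pochhammer (\<tau> + 3) (2 * n) = B * Q"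
    using pochhammer_product'[of "\<tau> + 2" n "Suc n"] pochhammer_rec[of "\<tau> + 2" "2 * n"]
    by (simp add: B_def Q_def mult_2 add_ac del: pochhammer_Suc)
  have "fact (n + 1) * fact n
            * ((falling_fact (real n + \<tau> + 1) n * falling_fact (real n + \<tau>) n)
               / (falling_fact (2 * real n + \<tau> + 2) (2 * n)
                  * falling_fact (2 * real n + \<tau> + 1) (2 * n)))
      = fact (n + 1) * fact n
            * ((B * A) / (pochhammer (\<tau> + 3) (2 * n) * pochhammer (\<tau> + 2) (2 * n)))"
    by (simp add: falling_fact_eq_pochhammer A_def B_def algebra_simps)
  also have "pochhammer (\<tau> + 3) (2 * n) = B * Q / (\<tau> + 2)"
    using BQ assms by (simp add: field_simps)
  also have "pochhammer (\<tau> + 2) (2 * n) = A * P / (\<tau> + 1)"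
    using AP assms by (simp add: field_simps)
  also have "fact (n + 1) * fact n * ((B * A) / (B * Q / (\<tau> + 2) * (A * P / (\<tau> + 1))))
      = reiswich_norm \<tau> n"
    using pos unfolding reiswich_norm_def P_def[symmetric] Q_def[symmetric]
    by (simp add: mult_ac del: fact_Suc)
  finally show ?thesis
    by simp
qed

text \<open>One denominator of the moment cancels against a factor of the coefficient for every k
  \<le> n. Division by the other one, j + a, reduces the sum to p(-a), so both cases are decided by
  whether -a is a root of p.\<close>

lemma reiswich_poly_moment:
  assumes "\<tau> > -1" "k \<le> n"
  shows "(\<Sum>j\<le>n. coeff (reiswich_poly \<tau> n) j * reiswich_moment \<tau> (j + k))
       = (if k = n then reiswich_norm \<tau> n else 0)"
proof -
  \<comment> \<open>As a polynomial in j this is the rising product of the coefficient without the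
    factor j+k+\<tau>+1, which the moment cancels.\<close>
  define p where "p = (\<Prod>i\<in>{..n} - {k}. [:\<tau> + 1 + real i, 1:])"
  define D where "D = pochhammer (real n + \<tau> + 1) (Suc n)"
  define a where "a = real k + \<tau> + 2"
  have "degree p = n"
    unfolding p_def using assms by (subst degree_prod_eq_sum_degree) auto
  have a: "a + real j \<noteq> 0" for j
    using assms by (simp add: a_def)
  have "coeff (reiswich_poly \<tau> n) j * reiswich_moment \<tau> (j + k)
      = (\<tau> + 2) * (\<tau> + 1) * (-1) ^ n / D
        * ((-1) ^ j * of_nat (n choose j) * (poly p (of_nat j) / (of_nat j + a)))" if "j \<le> n" for j
  proof -
    have "pochhammer (real j + \<tau> + 1) (Suc n) = (\<Prod>i\<le>n. \<tau> + 1 + real i + real j)"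
      by (simp add: pochhammer_prod atLeast0LessThan lessThan_Suc_atMost add_ac)
    also have "\<dots> = (real j + real k + \<tau> + 1) * poly p (real j)"
      using assms by (subst prod.remove[of _ k]) (auto simp: p_def poly_prod add_ac)
    finally have "pochhammer (real j + \<tau> + 1) (Suc n) / (real j + real k + \<tau> + 1) = poly p (real j)"
      using assms by simp
    moreover have "coeff (reiswich_poly \<tau> n) j * reiswich_moment \<tau> (j + k)
        = (\<tau> + 2) * (\<tau> + 1) * (-1) ^ n / D * ((-1) ^ j * real (n choose j)
          * (pochhammer (real j + \<tau> + 1) (Suc n) / (real j + real k + \<tau> + 1) / (real j + a)))"
      unfolding coeff_reiswich_poly[OF assms(1) that] reiswich_moment_def D_def[symmetric] a_def
      by (simp add: power_add add_ac mult_ac del: pochhammer_Suc)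
    ultimately show ?thesis
      by simp
  qed
  then have "(\<Sum>j\<le>n. coeff (reiswich_poly \<tau> n) j * reiswich_moment \<tau> (j + k))
      = (\<tau> + 2) * (\<tau> + 1) * (-1) ^ n / D
        * (\<Sum>j\<le>n. (-1) ^ j * of_nat (n choose j) * (poly p (of_nat j) / (of_nat j + a)))"
    unfolding sum_distrib_left by (intro sum.cong) auto
  also have "\<dots> = (\<tau> + 2) * (\<tau> + 1) * (-1) ^ n / D
        * (poly p (- a) * fact n / pochhammer a (Suc n))"
    using alternating_binomial_sum_poly_div[of p n a] \<open>degree p = n\<close> a by simp
  also have "\<dots> = (if k = n then reiswich_norm \<tau> n else 0)"
  proof (cases "k = n")
    case True
    \<comment> \<open>With a = n+\<tau>+2 the factor of index i is i-n-1. The product over i < n is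
      therefore (n+1)! up to the sign (-1)^n, which the sign of the coefficients absorbs.\<close>
    have "poly p (- a) = (\<Prod>i<n. - (real (Suc n) - real i))"
      unfolding p_def poly_prod using True by (intro prod.cong) (auto simp: a_def)
    also have "\<dots> = (-1) ^ n * falling_fact (real (Suc n)) n"
      by (simp only: falling_fact_def prod_uminus card_lessThan)
    also have "falling_fact (real (Suc n)) n = fact (n + 1)"
      by (simp add: falling_fact_eq_pochhammer pochhammer_fact[of "Suc n"] pochhammer_rec[of 1 n]
          del: pochhammer_Suc fact_Suc)
    finally show ?thesis
      using True
      by (simp add: reiswich_norm_def D_def a_def mult_ac power_mult_distrib[symmetric]
          del: pochhammer_Suc fact_Suc)
  next
    case False
    \<comment> \<open>For k < n the index k+1 still occurs in the product, and its factor vanishes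
      at -a = -(k+\<tau>+2).\<close>
    then have "poly p (- a) = 0"
      using assms unfolding p_def poly_prod
      by (intro prod_zero) (auto intro!: bexI[of _ "Suc k"] simp: a_def)
    then show ?thesis
      using False by simp
  qed
  finally show ?thesis .
qed

section \<open>Orthogonality with respect to the weight\<close>

lemma has_bochner_integral_reiswich_poly:
  assumes "\<tau> > -1"
  shows "has_bochner_integral lborel
      (\<lambda>x. indicator {0..1} x * (poly (reiswich_poly \<tau> n) x * poly (reiswich_poly \<tau> m) x
        * ((\<tau> + 2) * (\<tau> + 1) * (1 - x) * x powr \<tau>)))
      (if n = m then reiswich_norm \<tau> n else 0)"
proof -
  \<comment> \<open>The factor of lower degree is the one expanded into monomials x^k with k \<le> m
    \<le> n. Only k = n can survive, which forces m = n; the remaining case follows by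
    symmetry.\<close>
  have le: "has_bochner_integral lborel
      (\<lambda>x. indicator {0..1} x * (poly (reiswich_poly \<tau> n) x * poly (reiswich_poly \<tau> m) x
        * ((\<tau> + 2) * (\<tau> + 1) * (1 - x) * x powr \<tau>)))
      (if n = m then reiswich_norm \<tau> n else 0)" if "m \<le> n" for n m
  proof -
    have "(\<Sum>k\<le>m. coeff (reiswich_poly \<tau> m) k
            * (\<Sum>j\<le>n. coeff (reiswich_poly \<tau> n) j * reiswich_moment \<tau> (j + k)))
        = (\<Sum>k\<le>m. if k = n then coeff (reiswich_poly \<tau> m) k * reiswich_norm \<tau> n else 0)"
      using that by (intro sum.cong) (auto simp: reiswich_poly_moment[OF assms])
    also have "\<dots> = (if n = m then reiswich_norm \<tau> n else 0)"
      using that by (auto simp: coeff_reiswich_poly_self)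
    finally show ?thesis
      using has_bochner_integral_poly_mult[OF assms, of "reiswich_poly \<tau> n" "reiswich_poly \<tau> m"]
      by (simp only: degree_reiswich_poly)
  qed
  show ?thesis
  proof (cases "m \<le> n")
    case True
    then show ?thesis by (rule le)
  next
    case False
    then show ?thesis
      using le[of n m] by (subst mult.commute[of "poly (reiswich_poly \<tau> n) _"]) simp
  qed
qed

section \<open>Transfer to the probability measure\<close>

lemma has_bochner_integral_reiswich_measure:
  assumes "\<tau> > -1" and [measurable]: "f \<in> borel_measurable borel"
    and "has_bochner_integral lborel
      (\<lambda>x. indicator {0..1} x * (f x * ((\<tau> + 2) * (\<tau> + 1) * (1 - x) * x powr \<tau>))) I"
  shows "has_bochner_integral (reiswich_measure \<tau>) f I"
proof -
  let ?w = "\<lambda>x. (\<tau> + 2) * (\<tau> + 1) * (1 - x) * x powr \<tau>"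
  let ?R = "restrict_space lborel {0..1 :: real}"
  have f: "f \<in> borel_measurable ?R" and w: "?w \<in> borel_measurable ?R"
    by (auto intro!: measurable_restrict_space1)
  \<comment> \<open>\<open>ennreal\<close> truncates negative values to 0, so the density agrees
    with the weight only where 1 - x \<ge> 0; the restriction to [0,1] ensures this.\<close>
  have nonneg: "AE x in ?R. 0 \<le> ?w x"
    using assms(1) by (intro AE_I2) (auto simp: space_restrict_space)
  show ?thesis
    using assms(3) unfolding has_bochner_integral_iff reiswich_measure_def
      integrable_real_density[OF w nonneg f] integral_real_density[OF w nonneg f]
    by (subst integrable_restrict_space integral_restrict_space; simp add: mult_ac)+
qed

text \<open>The total mass is the moment of order 0, where the normalizing constant cancels
  exactly.\<close>

lemma prob_space_reiswich_measure:
  assumes "\<tau> > -1"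
  shows "prob_space (reiswich_measure \<tau>)"
proof (rule prob_spaceI)
  let ?M = "reiswich_measure \<tau>"
  have "reiswich_moment \<tau> 0 = 1"
    using assms by (simp add: reiswich_moment_def mult.commute)
  then have "has_bochner_integral lborel
      (\<lambda>x. indicator {0..1} x * (1 * ((\<tau> + 2) * (\<tau> + 1) * (1 - x) * x powr \<tau>))) 1"
    using has_bochner_integral_reiswich_moment[OF assms, of 0] by simp
  from has_bochner_integral_reiswich_measure[OF assms _ this]
  have one: "integrable ?M (\<lambda>_. 1 :: real)" "(LINT x|?M. 1) = (1 :: real)"
    unfolding has_bochner_integral_iff by simp_all
  have "emeasure ?M (space ?M) = (\<integral>\<^sup>+x. ennreal 1 \<partial>?M)"
    by simp
  also have "\<dots> = ennreal (LINT x|?M. 1)"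
    using one(1) by (rule nn_integral_eq_integral) simp
  also have "\<dots> = 1"
    unfolding one(2) by simp
  finally show "emeasure ?M (space ?M) = 1" .
qed

theorem theorem1p2:
  fixes \<tau> :: real
  assumes "\<tau> > -1"
  shows "prob_space (reiswich_measure \<tau>)
    \<and> orthogonal_polynomial_sequence (reiswich_measure \<tau>) (reiswich_poly \<tau>)
    \<and> (\<forall>n m :: nat.
        set_integrable lborel {0..1}
          (\<lambda>x. poly (reiswich_poly \<tau> n) x * poly (reiswich_poly \<tau> m) x
                 * ((\<tau> + 2) * (\<tau> + 1) * (1 - x) * x powr \<tau>))
      \<and> (LINT x:{0..1}|lborel. poly (reiswich_poly \<tau> n) x * poly (reiswich_poly \<tau> m) x
                 * ((\<tau> + 2) * (\<tau> + 1) * (1 - x) * x powr \<tau>))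
        = fact (n + 1) * fact n
            * ((falling_fact (real n + \<tau> + 1) n * falling_fact (real n + \<tau>) n)
               / (falling_fact (2 * real n + \<tau> + 2) (2 * n)
                  * falling_fact (2 * real n + \<tau> + 1) (2 * n)))
            * (if n = m then 1 else 0))"
proof -
  let ?R = "reiswich_poly \<tau>"
  note I = has_bochner_integral_reiswich_poly[OF assms]
  have M: "has_bochner_integral (reiswich_measure \<tau>) (\<lambda>x. poly (?R n) x * poly (?R m) x)
      (if n = m then reiswich_norm \<tau> n else 0)" for n m
    using assms I
    by (intro has_bochner_integral_reiswich_measure borel_measurable_continuous_onI continuous_intros)
  have "orthogonal_polynomial_sequence (reiswich_measure \<tau>) ?R"
    unfolding orthogonal_polynomial_sequence_def
    using M reiswich_norm_pos[OF assms]
    by (auto simp: degree_reiswich_poly has_bochner_integral_iff less_imp_neq[symmetric])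
  then show ?thesis
    \<comment> \<open>Reading the norm identity from right to left turns the stated constant into
      \<open>reiswich_norm \<tau> n\<close>; with the set integrals unfolded to indicators, the
      claim is then the integral \<open>I\<close>.\<close>
    using prob_space_reiswich_measure[OF assms] I
    unfolding reiswich_norm_eq[OF assms, symmetric] set_integrable_def set_lebesgue_integral_def
    by (auto simp: has_bochner_integral_iff)
qed

end
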